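(* Let $\mathbf L=(L,\vee,\wedge,0,1)$ be a Stonean lattice (a bounded lattice satisfying the Ascending Chain Condition in which $1\in x^{00}\vee y^{00}$ for every $x\in L$ and every $y\in x^0$). Then the condition "for all $x,y\in L$: $x\vee y\in D$ if and only if $1\in x^{00}\vee y^{00}$" is equivalent to each single one of the following statements: (i) $\overline F=F^D$ for all filters $F$ of $\mathbf L$; (ii) $\overline x=x^D$ for all $x\in L$; (iii) for every two filters $F,G$ of $\mathbf L$, $F\cap G\subseteq D$ is equivalent to $F\subseteq\overline G$.
   Context: Singletons are identified with their unique element. For subsets $A,B$ of $L$: $A\vee B:=\{x\vee y\mid x\in A, y\in B\}$, and $A^0$ is the set of all maximal elements of $\{x\in L\mid x\wedge y=0\text{ for all }y\in A\}$; for $a\in L$, $a^0:=\{a\}^0$ and $a^{00}:=(a^0)^0$. $D:=\{a\in L\mid a^0=\{0\}\}$ is the set of dense elements. For $A\subseteq L$: $\overline A:=\{x\in L\mid 1\in x^{00}\vee y^{00}\text{ for each }y\in A\}$ and $A^D:=\{x\in L\mid x\vee y\in D\text{ for all }y\in A\}$; $\overline x:=\overline{\{x\}}$, $x^D:=\{x\}^D$. A filter of $\mathbf L$ is a non-empty subset $F$ of $L$ with $x\wedge y,\ x\vee z\in F$ for all $x,y\in F$ and $z\in L$ (so $L$ itself is a filter). *)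

theory Defs
  imports Main
begin

definition acc_lattice :: "'a::bounded_lattice itself \<Rightarrow> bool" where
  "acc_lattice _ \<longleftrightarrow> (\<forall>c :: nat \<Rightarrow> 'a. mono c \<longrightarrow> (\<exists>n. \<forall>m\<ge>n. c m = c n))"

definition set_join :: "'a::bounded_lattice set \<Rightarrow> 'a set \<Rightarrow> 'a set" where
  "set_join A B = {sup x y | x y. x \<in> A \<and> y \<in> B}"

definition annihilator :: "'a::bounded_lattice set \<Rightarrow> 'a set" where
  "annihilator A = {x. \<forall>y\<in>A. inf x y = bot}"

text \<open>The set \<open>A\<^sup>0\<close>. It consists of \<^emph>\<open>maximal\<close>, not greatest, elements, and in
  general it is not a singleton.\<close>

definition pcomp :: "'a::bounded_lattice set \<Rightarrow> 'a set" where
  "pcomp A = {x \<in> annihilator A. \<forall>z\<in>annihilator A. x \<le> z \<longrightarrow> z = x}"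

text \<open>The set \<open>a\<^sup>0\<^sup>0\<close>. The outer operator acts on the set \<open>a\<^sup>0\<close> as a whole.\<close>

definition pcomp2 :: "'a::bounded_lattice \<Rightarrow> 'a set" where
  "pcomp2 a = pcomp (pcomp {a})"

definition dense_elems :: "'a::bounded_lattice set" where
  "dense_elems = {a. pcomp {a} = {bot}}"

definition stonean_lattice :: "'a::bounded_lattice itself \<Rightarrow> bool" where
  "stonean_lattice T \<longleftrightarrow> acc_lattice T \<and>
     (\<forall>x::'a. \<forall>y\<in>pcomp {x}. top \<in> set_join (pcomp2 x) (pcomp2 y))"

text \<open>The sets written as \<open>A\<close> with an overline and as \<open>A\<^sup>D\<close>, respectively.\<close>

definition overline :: "'a::bounded_lattice set \<Rightarrow> 'a set" where
  "overline A = {x. \<forall>y\<in>A. top \<in> set_join (pcomp2 x) (pcomp2 y)}"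

definition codense :: "'a::bounded_lattice set \<Rightarrow> 'a set" where
  "codense A = {x. \<forall>y\<in>A. sup x y \<in> dense_elems}"

definition lattice_filter :: "'a::bounded_lattice set \<Rightarrow> bool" where
  "lattice_filter F \<longleftrightarrow> F \<noteq> {} \<and> (\<forall>x\<in>F. \<forall>y\<in>F. \<forall>z. inf x y \<in> F \<and> sup x z \<in> F)"

end

theory Submission imports Defs begin

text \<open>Under the ascending chain condition every element of an annihilator lies below a maximal
  one. Hence density is upward closed and \<open>1 \<in> x\<^sup>0\<^sup>0 \<or> y\<^sup>0\<^sup>0\<close> persists when \<open>x\<close> or \<open>y\<close>
  is enlarged, so that on principal filters each of the three statements reduces to the
  corresponding statement about the generators.\<close>

text \<open>The chain condition makes the converse of \<open><\<close> well-founded, since an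
  infinite descent for it is a strictly increasing sequence. A minimal element for this relation is
  maximal for \<open>\<le>\<close>.\<close>

lemma acc_lattice_maximal_above:
  fixes A :: "'a::bounded_lattice set"
  assumes "acc_lattice TYPE('a)" and "z \<in> A"
  obtains m where "m \<in> A" "z \<le> m" "\<forall>w\<in>A. m \<le> w \<longrightarrow> w = m"
proof -
  have "wf {(y, x :: 'a). x < y}"
    unfolding wf_iff_no_infinite_down_chain
  proof
    assume "\<exists>f. \<forall>i. (f (Suc i), f i) \<in> {(y, x :: 'a). x < y}"
    then obtain f :: "nat \<Rightarrow> 'a" where f: "f i < f (Suc i)" for i
      by auto
    then have "mono f"
      unfolding mono_iff_le_Suc by (blast intro: less_imp_le)
    then obtain n where "\<forall>m\<ge>n. f m = f n"
      using assms(1) unfolding acc_lattice_def by blast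
    then have "f (Suc n) = f n"
      by (blast intro: le_SucI)
    with f[of n] show False
      by simp
  qed
  \<comment> \<open>Minimising over the members of \<open>A\<close> above \<open>z\<close> forces
    \<open>z \<le> m\<close>. Maximality then holds in all of \<open>A\<close>, because whatever
    lies above \<open>m\<close> also lies above \<open>z\<close>.\<close>
  moreover have "z \<in> {w \<in> A. z \<le> w}"
    using assms(2) by simp
  ultimately obtain m where "m \<in> {w \<in> A. z \<le> w}"
      and max: "\<And>y. (y, m) \<in> {(y, x). x < y} \<Longrightarrow> y \<notin> {w \<in> A. z \<le> w}"
    by (rule wfE_min) blast
  then have m: "m \<in> A" "z \<le> m"
    by auto
  have "w = m" if "w \<in> A" "m \<le> w" for w
    using max[of w] m(2) that order_trans[OF m(2) that(2)] by (auto simp: less_le)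
  with m show thesis
    by (intro that[of m]) simp_all
qed

lemma pcomp_above:
  fixes A :: "'a::bounded_lattice set"
  assumes "acc_lattice TYPE('a)" and "z \<in> annihilator A"
  obtains m where "m \<in> pcomp A" "z \<le> m"
proof -
  obtain m where "m \<in> annihilator A" "z \<le> m" "\<forall>w\<in>annihilator A. m \<le> w \<longrightarrow> w = m"
    by (rule acc_lattice_maximal_above[OF assms])
  then show thesis
    by (intro that[of m]) (simp_all add: pcomp_def)
qed

lemma annihilator_singleton_antimono:
  fixes x y :: "'a::bounded_lattice"
  assumes "x \<le> y"
  shows "annihilator {y} \<subseteq> annihilator {x}"
proof
  fix z
  assume "z \<in> annihilator {y}"
  then have "inf z x \<le> bot"
    using inf_mono[OF order_refl assms, of z] by (simp add: annihilator_def)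
  then show "z \<in> annihilator {x}"
    by (simp add: annihilator_def bot_unique)
qed

text \<open>If \<open>bot\<close> is the only maximal annihilating element, every annihilating
  element lies below it. This trades \<open>pcomp\<close>, which keeps only maximal elements, for
  \<open>annihilator\<close>, which is antitone.\<close>

lemma dense_iff_annihilator:
  fixes a :: "'a::bounded_lattice"
  assumes "acc_lattice TYPE('a)"
  shows "a \<in> dense_elems \<longleftrightarrow> annihilator {a} = {bot}"
proof
  assume "a \<in> dense_elems"
  then have "pcomp {a} = {bot}"
    by (simp add: dense_elems_def)
  then have "z = bot" if "z \<in> annihilator {a}" for z
    by (metis pcomp_above[OF assms that] singletonD bot_unique)
  then show "annihilator {a} = {bot}"
    by (auto simp: annihilator_def)
qed (auto simp: dense_elems_def pcomp_def)

lemma dense_elems_upward_closed: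
  fixes a b :: "'a::bounded_lattice"
  assumes "acc_lattice TYPE('a)" and "a \<in> dense_elems" and "a \<le> b"
  shows "b \<in> dense_elems"
  using assms annihilator_singleton_antimono[OF assms(3)]
  by (auto simp: dense_iff_annihilator annihilator_def)

text \<open>Each \<open>u\<close> in \<open>pcomp {y}\<close> annihilates \<open>x\<close> and so
  lies below some \<open>v\<close> in \<open>pcomp {x}\<close>; from \<open>inf a v = bot\<close> it
  follows that \<open>a\<close> annihilates \<open>pcomp {y}\<close>, and \<open>a\<close> extends
  to a maximal such element. Plain inclusion fails in general: for \<open>bot \<le> top\<close> the
  two sets are \<open>{bot}\<close> and \<open>{top}\<close>.\<close>

lemma pcomp2_mono:
  fixes x y :: "'a::bounded_lattice"
  assumes acc: "acc_lattice TYPE('a)" and "x \<le> y" and "a \<in> pcomp2 x"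
  obtains b where "b \<in> pcomp2 y" "a \<le> b"
proof -
  have a: "a \<in> annihilator (pcomp {x})"
    using assms(3) by (simp add: pcomp2_def pcomp_def)
  have "inf a u = bot" if "u \<in> pcomp {y}" for u
  proof -
    have "u \<in> annihilator {x}"
      using that annihilator_singleton_antimono[OF \<open>x \<le> y\<close>] by (auto simp: pcomp_def)
    then obtain v where "v \<in> pcomp {x}" "u \<le> v"
      by (rule pcomp_above[OF acc])
    then have "inf a u \<le> inf a v" "inf a v = bot"
      using a inf_mono[OF order_refl, of u v a] by (simp_all add: annihilator_def)
    then show ?thesis
      by (simp add: bot_unique)
  qed
  then have "a \<in> annihilator (pcomp {y})"
    by (simp add: annihilator_def)
  then obtain b where "b \<in> pcomp (pcomp {y})" "a \<le> b"
    by (rule pcomp_above[OF acc])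
  then show thesis
    by (intro that[of b]) (simp_all add: pcomp2_def)
qed

lemma top_in_set_join_pcomp2_mono:
  fixes x x' y y' :: "'a::bounded_lattice"
  assumes acc: "acc_lattice TYPE('a)" and "x \<le> x'" and "y \<le> y'"
    and "top \<in> set_join (pcomp2 x) (pcomp2 y)"
  shows "top \<in> set_join (pcomp2 x') (pcomp2 y')"
proof -
  obtain a b where ab: "a \<in> pcomp2 x" "b \<in> pcomp2 y" "top = sup a b"
    using assms(4) unfolding set_join_def by blast
  obtain a' where a': "a' \<in> pcomp2 x'" "a \<le> a'"
    using pcomp2_mono[OF acc \<open>x \<le> x'\<close> ab(1)] .
  obtain b' where b': "b' \<in> pcomp2 y'" "b \<le> b'"
    using pcomp2_mono[OF acc \<open>y \<le> y'\<close> ab(2)] .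
  have "top = sup a' b'"
    using ab(3) sup_mono[OF a'(2) b'(2)] by (simp add: top_unique)
  with a'(1) b'(1) show ?thesis
    unfolding set_join_def by blast
qed

lemma lattice_filter_atLeast: "lattice_filter {x::'a::bounded_lattice..}"
  unfolding lattice_filter_def by (auto intro: le_supI1)

text \<open>The generator is the least element of its filter, and the condition it imposes is
  inherited by all larger elements.\<close>

lemma overline_atLeast:
  fixes x :: "'a::bounded_lattice"
  assumes "acc_lattice TYPE('a)"
  shows "overline {x..} = overline {x}"
  unfolding overline_def
  using top_in_set_join_pcomp2_mono[OF assms order_refl] by auto

lemma codense_atLeast:
  fixes x :: "'a::bounded_lattice"
  assumes "acc_lattice TYPE('a)"
  shows "codense {x..} = codense {x}"
  unfolding codense_def
  using dense_elems_upward_closed[OF assms] by (auto intro: sup_mono)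

lemma atLeast_subset_dense_elems:
  fixes x :: "'a::bounded_lattice"
  assumes "acc_lattice TYPE('a)"
  shows "{x..} \<subseteq> dense_elems \<longleftrightarrow> x \<in> dense_elems"
  using dense_elems_upward_closed[OF assms] by auto

lemma atLeast_subset_overline:
  fixes x :: "'a::bounded_lattice"
  assumes "acc_lattice TYPE('a)"
  shows "{x..} \<subseteq> overline A \<longleftrightarrow> x \<in> overline A"
  unfolding overline_def
  using top_in_set_join_pcomp2_mono[OF assms _ order_refl] by auto

theorem theorem3p6:
  assumes "stonean_lattice TYPE('a::bounded_lattice)"
  shows "let C = (\<forall>x y :: 'a. sup x y \<in> dense_elems \<longleftrightarrow> top \<in> set_join (pcomp2 x) (pcomp2 y)) in
      (C \<longleftrightarrow> (\<forall>F :: 'a set. lattice_filter F \<longrightarrow> overline F = codense F)) \<and>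
      (C \<longleftrightarrow> (\<forall>x :: 'a. overline {x} = codense {x})) \<and>
      (C \<longleftrightarrow> (\<forall>F G :: 'a set. lattice_filter F \<and> lattice_filter G \<longrightarrow>
                 (F \<inter> G \<subseteq> dense_elems \<longleftrightarrow> F \<subseteq> overline G)))"
proof -
  have acc: "acc_lattice TYPE('a)"
    using assms by (simp add: stonean_lattice_def)
  define C where
    "C = (\<forall>x y :: 'a. sup x y \<in> dense_elems \<longleftrightarrow> top \<in> set_join (pcomp2 x) (pcomp2 y))"
  \<comment> \<open>Read elementwise, equality of the two sets for every \<open>x\<close> is
    \<open>C\<close> with its variables renamed.\<close>
  have singletons: "C \<longleftrightarrow> (\<forall>x :: 'a. overline {x} = codense {x})"
    unfolding C_def overline_def codense_def by auto
  have filters: "C \<longleftrightarrow> (\<forall>F :: 'a set. lattice_filter F \<longrightarrow> overline F = codense F)"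
  proof
    assume C
    then show "\<forall>F :: 'a set. lattice_filter F \<longrightarrow> overline F = codense F"
      by (simp add: C_def overline_def codense_def)
  next
    assume "\<forall>F :: 'a set. lattice_filter F \<longrightarrow> overline F = codense F"
    \<comment> \<open>Principal filters suffice to recover the statement on singletons.\<close>
    then have "overline {x..} = codense {x..}" for x :: 'a
      by (simp add: lattice_filter_atLeast)
    then show C
      by (simp add: singletons overline_atLeast[OF acc] codense_atLeast[OF acc])
  qed
  have pairs: "C \<longleftrightarrow> (\<forall>F G :: 'a set. lattice_filter F \<and> lattice_filter G \<longrightarrow>
      (F \<inter> G \<subseteq> dense_elems \<longleftrightarrow> F \<subseteq> overline G))"
  proof
    assume C: C
    show "\<forall>F G :: 'a set. lattice_filter F \<and> lattice_filter G \<longrightarrow>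
      (F \<inter> G \<subseteq> dense_elems \<longleftrightarrow> F \<subseteq> overline G)"
    proof (intro allI impI iffI subsetI)
      fix F G :: "'a set" and x
      assume FG: "lattice_filter F \<and> lattice_filter G" "F \<inter> G \<subseteq> dense_elems" "x \<in> F"
      \<comment> \<open>The join of a member of \<open>F\<close> with a member of \<open>G\<close>
        lies in both filters.\<close>
      have "sup x y \<in> dense_elems" if "y \<in> G" for y
      proof -
        have "sup x y \<in> F" "sup y x \<in> G"
          using FG that unfolding lattice_filter_def by blast+
        then show ?thesis
          using FG(2) by (auto simp: sup_commute)
      qed
      then show "x \<in> overline G"
        using C by (simp add: C_def overline_def)
    next
      fix F G :: "'a set" and x
      assume "F \<subseteq> overline G" "x \<in> F \<inter> G"
      \<comment> \<open>A common member \<open>x\<close> plays both roles, so \<open>C\<close> is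
        applied to the pair \<open>x\<close>, \<open>x\<close>.\<close>
      then have "top \<in> set_join (pcomp2 x) (pcomp2 x)"
        unfolding overline_def by blast
      then have "sup x x \<in> dense_elems"
        using C unfolding C_def by blast
      then show "x \<in> dense_elems"
        by simp
    qed
  next
    assume iii: "\<forall>F G :: 'a set. lattice_filter F \<and> lattice_filter G \<longrightarrow>
      (F \<inter> G \<subseteq> dense_elems \<longleftrightarrow> F \<subseteq> overline G)"
    have "sup x y \<in> dense_elems \<longleftrightarrow> x \<in> overline {y}" for x y :: 'a
    proof -
      \<comment> \<open>Intersecting principal filters joins their generators, which turns the
        filter statement into one about \<open>sup x y\<close>.\<close>
      have "{x..} \<inter> {y..} = {sup x y..}"
        by auto
      moreover have "{x..} \<inter> {y..} \<subseteq> dense_elems \<longleftrightarrow> {x..} \<subseteq> overline {y..}"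
        using iii lattice_filter_atLeast by blast
      ultimately show ?thesis
        by (simp add: atLeast_subset_dense_elems[OF acc] atLeast_subset_overline[OF acc]
            overline_atLeast[OF acc])
    qed
    then show C
      by (simp add: C_def overline_def)
  qed
  from filters singletons pairs show ?thesis
    unfolding Let_def C_def by blast
qed

end
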